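(* For three agents, if one agent has an additive $2$-ratio-bounded cost function and the other two have arbitrary monotone cost functions, then a full tEFX allocation of the chores $[m]$ exists.
   Context: A cost function $C:2^{[m]}\to\mathbb{R}_{\ge0}$ is monotone if $C(S\cup\{c\})\ge C(S)$; additive if $C(S)=\sum_{c\in S}C(\{c\})$; $2$-ratio-bounded if $\max_b C(\{b\})\le 2\min_b C(\{b\})$ with positive single-chore costs. A full allocation $X=(X_1,X_2,X_3)$ (a partition of $[m]$) is tEFX if for all agents $i,j$ and every $c\in X_i$, $C_i(X_i\setminus\{c\})\le C_i(X_j\cup\{c\})$. *)

theory Defs
  imports Complex_Main
begin

text \<open>Chores are the set {0..<m}; a cost function is a function on sets of chores,
  only its values on subsets of {0..<m} matter.\<close>

definition nonneg_cost :: "nat \<Rightarrow> (nat set \<Rightarrow> real) \<Rightarrow> bool" where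
  "nonneg_cost m C \<longleftrightarrow> (\<forall>S \<subseteq> {0..<m}. C S \<ge> 0)"

definition monotone_cost :: "nat \<Rightarrow> (nat set \<Rightarrow> real) \<Rightarrow> bool" where
  "monotone_cost m C \<longleftrightarrow> nonneg_cost m C \<and>
     (\<forall>S \<subseteq> {0..<m}. \<forall>c \<in> {0..<m}. C (S \<union> {c}) \<ge> C S)"

definition additive_cost :: "nat \<Rightarrow> (nat set \<Rightarrow> real) \<Rightarrow> bool" where
  "additive_cost m C \<longleftrightarrow> nonneg_cost m C \<and>
     (\<forall>S \<subseteq> {0..<m}. C S = (\<Sum>c\<in>S. C {c}))"

definition two_ratio_bounded :: "nat \<Rightarrow> (nat set \<Rightarrow> real) \<Rightarrow> bool" where
  "two_ratio_bounded m C \<longleftrightarrow> (\<forall>b \<in> {0..<m}. C {b} > 0) \<and>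
     (\<forall>a \<in> {0..<m}. \<forall>b \<in> {0..<m}. C {a} \<le> 2 * C {b})"

definition full_allocation3 :: "nat \<Rightarrow> (nat \<Rightarrow> nat set) \<Rightarrow> bool" where
  "full_allocation3 m X \<longleftrightarrow>
     (\<Union>i<3. X i) = {0..<m} \<and> (\<forall>i<3. \<forall>j<3. i \<noteq> j \<longrightarrow> X i \<inter> X j = {})"

definition tEFX3 :: "(nat \<Rightarrow> nat set \<Rightarrow> real) \<Rightarrow> (nat \<Rightarrow> nat set) \<Rightarrow> bool" where
  "tEFX3 C X \<longleftrightarrow>
     (\<forall>i<3. \<forall>j<3. \<forall>c \<in> X i. C i (X i - {c}) \<le> C i (X j \<union> {c}))"

end

theory Submission
  imports Defs
begin

text \<open>
  Let \<open>\<mu>\<close> be the smallest single-chore cost of the additive agent, so that every chore costs it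
  between \<open>\<mu>\<close> and \<open>2\<mu>\<close>; a bundle is acceptable to this agent as soon as it exceeds
  no other bundle by more than \<open>2\<mu>\<close>. Call the other agents \<open>f\<close> and \<open>g\<close>. We keep a partition \<open>(A, B, D)\<close> in which
  the additive agent accepts \<open>A\<close> and \<open>B\<close>, and \<open>D\<close> is a cheapest bundle for \<open>f\<close>; a partition
  balanced for the additive agent provides a first one. If \<open>g\<close> accepts \<open>A\<close> or \<open>B\<close>, then \<open>f\<close> takes
  \<open>D\<close>; if \<open>f\<close> accepts \<open>A\<close> or \<open>B\<close> and \<open>g\<close> does not, then \<open>g\<close> takes \<open>D\<close>. If
  neither accepts \<open>A\<close> or \<open>B\<close>, the chores witnessing that \<open>f\<close> rejects \<open>A\<close> and \<open>B\<close> allow a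
  rearrangement that enlarges \<open>D\<close> by one chore and keeps the invariant, so the process stops.
\<close>

section \<open>Acceptance of one bundle against another\<close>

text \<open>This is the tEFX condition for one ordered pair of bundles.\<close>

definition tolerates :: "('a set \<Rightarrow> real) \<Rightarrow> 'a set \<Rightarrow> 'a set \<Rightarrow> bool" where
  "tolerates f P Q \<longleftrightarrow> (\<forall>c\<in>P. f (P - {c}) \<le> f (insert c Q))"

definition partition3 :: "'a set \<Rightarrow> 'a set \<Rightarrow> 'a set \<Rightarrow> 'a set \<Rightarrow> bool" where
  "partition3 M A B D \<longleftrightarrow>
     A \<union> B \<union> D = M \<and> A \<inter> B = {} \<and> A \<inter> D = {} \<and> B \<inter> D = {}"

definition mono_within :: "'a set \<Rightarrow> ('a set \<Rightarrow> real) \<Rightarrow> bool" where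
  "mono_within M f \<longleftrightarrow> (\<forall>A B. A \<subseteq> B \<longrightarrow> B \<subseteq> M \<longrightarrow> f A \<le> f B)"

lemma mono_withinD: "mono_within M f \<Longrightarrow> A \<subseteq> B \<Longrightarrow> B \<subseteq> M \<Longrightarrow> f A \<le> f B"
  by (auto simp: mono_within_def)

lemma tolerates_if_le:
  assumes "mono_within M f" "P \<subseteq> M" "Q \<subseteq> M" "f P \<le> f Q"
  shows "tolerates f P Q"
  unfolding tolerates_def
proof
  fix c assume "c \<in> P"
  have "f (P - {c}) \<le> f P" "f Q \<le> f (insert c Q)"
    using assms \<open>c \<in> P\<close> by (auto intro!: mono_withinD[of M f])
  with assms(4) show "f (P - {c}) \<le> f (insert c Q)" by linarith
qed

section \<open>Weights within a factor of two\<close>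

locale ratio_bounded_weights =
  fixes M :: "'a set" and w :: "'a \<Rightarrow> real" and \<mu> :: real
  assumes finite_M: "finite M"
    and w_ge: "c \<in> M \<Longrightarrow> \<mu> \<le> w c"
    and w_le: "c \<in> M \<Longrightarrow> w c \<le> 2 * \<mu>"
begin

definition near :: "'a set \<Rightarrow> 'a set \<Rightarrow> bool" where
  "near P Q \<longleftrightarrow> sum w P \<le> sum w Q + 2 * \<mu>"

lemma sum_w_insert: "P \<subseteq> M \<Longrightarrow> c \<in> M \<Longrightarrow> c \<notin> P \<Longrightarrow> sum w (insert c P) = sum w P + w c"
  using finite_M finite_subset by (subst sum.insert) auto

lemma sum_w_remove: "P \<subseteq> M \<Longrightarrow> c \<in> P \<Longrightarrow> sum w (P - {c}) = sum w P - w c"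
  using finite_M finite_subset by (subst sum_diff1) auto

text \<open>Moving \<open>c\<close> from \<open>P\<close> to \<open>Q\<close> shifts the difference
  of the two weights by \<open>2 * w c\<close>, and this is at least the slack
  \<open>2 * \<mu>\<close>.\<close>

lemma tolerates_if_near:
  assumes "P \<subseteq> M" "Q \<subseteq> M" "P \<inter> Q = {}" "near P Q"
  shows "tolerates (sum w) P Q"
  unfolding tolerates_def
proof
  fix c assume "c \<in> P"
  then have "sum w (P - {c}) = sum w P - w c" "sum w (insert c Q) = sum w Q + w c" "\<mu> \<le> w c"
    using assms by (auto intro!: sum_w_remove sum_w_insert w_ge)
  with assms(4) show "sum w (P - {c}) \<le> sum w (insert c Q)"
    by (simp add: near_def)
qed

text \<open>Greedy: give each chore to a currently lightest bundle.\<close>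

lemma balanced_partition_exists:
  assumes "0 \<le> \<mu>"
  shows "\<exists>A B D. partition3 M A B D \<and> near A B \<and> near A D \<and> near B A \<and> near B D \<and> near D A \<and> near D B"
proof -
  define bal where "bal N A B D \<longleftrightarrow>
    partition3 N A B D \<and> near A B \<and> near A D \<and> near B A \<and> near B D \<and> near D A \<and> near D B" for N A B D
  have rot: "bal N B D A" if "bal N A B D" for N A B D
    using that by (auto simp: bal_def partition3_def)
  have "\<exists>A B D. bal N A B D" if "finite N" "N \<subseteq> M" for N
    using that
  proof (induction N rule: finite_induct)
    case empty
    have "bal {} {} {} {}" using assms by (simp add: bal_def partition3_def near_def)
    then show ?case by blast
  next
    case (insert c N)
    then obtain A B D where "bal N A B D" by auto
    \<comment> \<open>Balance is invariant under rotation, so the lightest bundle may be called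
      \<open>A\<close>.\<close>
    then have "\<exists>A B D. bal N A B D \<and> sum w A \<le> sum w B \<and> sum w A \<le> sum w D"
      using rot by (meson le_cases order_trans)
    then obtain A B D where p: "bal N A B D" and le: "sum w A \<le> sum w B" "sum w A \<le> sum w D"
      by blast
    have c: "c \<in> M" "c \<notin> N" using insert by auto
    have sub: "A \<subseteq> M" "c \<notin> A" "c \<notin> B" "c \<notin> D"
      using p c insert.prems by (auto simp: bal_def partition3_def)
    \<comment> \<open>Only \<open>A\<close> grows; it was lightest and gains at most
      \<open>2 * \<mu>\<close>.\<close>
    have "bal (insert c N) (insert c A) B D"
      using p le sub sum_w_insert[of A c] w_ge[of c] w_le[of c] c assms
      by (auto simp: bal_def partition3_def near_def)
    then show ?case by blast
  qed
  from this[OF finite_M] show ?thesis by (auto simp: bal_def)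
qed

section \<open>The invariant and the enlargement of \<open>D\<close>\<close>

text \<open>No bound on the weight of \<open>D\<close> from above: the additive agent never receives
  \<open>D\<close>, so \<open>D\<close> may grow freely.\<close>

definition keeps :: "('a set \<Rightarrow> real) \<Rightarrow> 'a set \<Rightarrow> 'a set \<Rightarrow> 'a set \<Rightarrow> bool" where
  "keeps f A B D \<longleftrightarrow> partition3 M A B D \<and> near A B \<and> near B A \<and> near A D \<and> near B D
     \<and> f D \<le> f A \<and> f D \<le> f B"

lemma keeps_commute: "keeps f A B D \<longleftrightarrow> keeps f B A D"
  by (auto simp: keeps_def partition3_def)

text \<open>Since \<open>f B \<le> f A\<close>, a rejection of \<open>B\<close> can only be against
  \<open>D\<close>; it yields a chore \<open>g\<close>. If the weights permit, \<open>g\<close>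
  moves to \<open>D\<close>. Otherwise a chore \<open>h\<close> witnessing the rejection of
  \<open>A\<close> moves to \<open>D\<close>, or else \<open>h\<close> moves to \<open>B\<close>
  while \<open>g\<close> moves to \<open>D\<close>.\<close>

lemma keeps_advance_ordered:
  assumes f: "mono_within M f" and k: "keeps f A B D" and le: "f B \<le> f A"
    and rA: "\<not> (tolerates f A B \<and> tolerates f A D)"
    and rB: "\<not> (tolerates f B A \<and> tolerates f B D)"
  shows "\<exists>A' B' D'. keeps f A' B' D' \<and> card D' = Suc (card D)"
proof -
  have sub: "A \<subseteq> M" "B \<subseteq> M" "D \<subseteq> M" and disj: "A \<inter> B = {}" "A \<inter> D = {}" "B \<inter> D = {}"
    and un: "A \<union> B \<union> D = M"
    using k by (auto simp: keeps_def partition3_def)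
  have fin: "finite D" using sub finite_M finite_subset by blast
  have fD: "f D \<le> f A" "f D \<le> f B" using k by (auto simp: keeps_def)
  have n: "sum w A \<le> sum w B + 2 * \<mu>" "sum w B \<le> sum w A + 2 * \<mu>"
    "sum w A \<le> sum w D + 2 * \<mu>" "sum w B \<le> sum w D + 2 * \<mu>"
    using k by (auto simp: keeps_def near_def)
  have "tolerates f B A" using tolerates_if_le[OF f] sub le by blast
  with rB obtain g where g: "g \<in> B" and fg: "f (insert g D) < f (B - {g})"
    by (auto simp: tolerates_def not_le)
  have gM: "g \<in> M" "g \<notin> A" "g \<notin> D" using g sub disj by auto
  have fBg: "f (B - {g}) \<le> f B" using mono_withinD[OF f] sub by blast
  have wg: "\<mu> \<le> w g" "w g \<le> 2 * \<mu>" using w_ge w_le gM by auto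
  have sBg: "sum w (B - {g}) = sum w B - w g" using sum_w_remove sub g by blast
  have sDg: "sum w (insert g D) = sum w D + w g" using sum_w_insert sub gM by blast
  have cg: "card (insert g D) = Suc (card D)" using fin gM by simp
  show ?thesis
  \<comment> \<open>The condition is exactly \<open>near A (B - {g})\<close>.\<close>
  proof (cases "sum w A - sum w B + w g \<le> 2 * \<mu>")
    case True
    have "partition3 M A (B - {g}) (insert g D)"
      using un disj g gM by (auto simp: partition3_def)
    then have "keeps f A (B - {g}) (insert g D)"
      using True n wg sBg sDg fg fBg le by (auto simp: keeps_def near_def)
    with cg show ?thesis by blast
  next
    case False
    from rA obtain h where h: "h \<in> A"
      and fh: "f (insert h B) < f (A - {h}) \<or> f (insert h D) < f (A - {h})"
      by (auto simp: tolerates_def not_le)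
    have hM: "h \<in> M" "h \<notin> B" "h \<notin> D" using h sub disj by auto
    have fBh: "f B \<le> f (insert h B)" using mono_withinD[OF f] sub hM by blast
    have wh: "\<mu> \<le> w h" "w h \<le> 2 * \<mu>" using w_ge w_le hM by auto
    have sAh: "sum w (A - {h}) = sum w A - w h" using sum_w_remove sub h by blast
    show ?thesis
    \<comment> \<open>Now \<open>A\<close> is heavier than \<open>B\<close>, so \<open>B\<close>
      exceeds \<open>A - {h}\<close> by at most \<open>w h \<le> 2 * \<mu>\<close>.\<close>
    proof (cases "f (insert h D) \<le> f (A - {h}) \<and> f (insert h D) \<le> f B")
      case True
      have "partition3 M (A - {h}) B (insert h D)"
        using un disj h hM by (auto simp: partition3_def)
      moreover have "sum w (insert h D) = sum w D + w h" using sum_w_insert sub hM by blast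
      ultimately have "keeps f (A - {h}) B (insert h D)"
        using True False n wg wh sAh by (auto simp: keeps_def near_def)
      moreover have "card (insert h D) = Suc (card D)" using fin hM by simp
      ultimately show ?thesis by blast
    next
      case notA: False
      have "partition3 M (A - {h}) (insert h (B - {g})) (insert g D)"
        using un disj g h gM hM by (auto simp: partition3_def)
      moreover have "sum w (insert h (B - {g})) = sum w B - w g + w h"
        using sum_w_insert[of "B - {g}" h] sub hM sBg by auto
      \<comment> \<open>Whichever bundle \<open>h\<close> witnesses against,
        \<open>f B < f (A - {h})\<close>: directly if it is \<open>B\<close>, and through
        \<open>f B < f (insert h D)\<close> if it is \<open>D\<close>.\<close>
      moreover have "f (insert g D) \<le> f (A - {h})"
        using notA fh fg fBg fBh by linarith
      moreover have "f (B - {g}) \<le> f (insert h (B - {g}))"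
        using sub hM by (intro mono_withinD[OF f]) auto
      \<comment> \<open>For the middle bundle against the new \<open>D\<close>: the failed weight
        condition and \<open>near A D\<close> give \<open>sum w B < sum w D + w g\<close>.\<close>
      ultimately have "keeps f (A - {h}) (insert h (B - {g})) (insert g D)"
        using False n wg wh sAh sDg fg by (auto simp: keeps_def near_def)
      with cg show ?thesis by blast
    qed
  qed
qed

lemma keeps_advance:
  assumes "mono_within M f" "keeps f A B D"
    and "\<not> (tolerates f A B \<and> tolerates f A D)" "\<not> (tolerates f B A \<and> tolerates f B D)"
  shows "\<exists>A' B' D'. keeps f A' B' D' \<and> card D' = Suc (card D)"
  using assms keeps_advance_ordered[of f A B D] keeps_advance_ordered[of f B A D]
    keeps_commute[of f A B D] by (meson le_cases)

section \<open>Assigning the bundles\<close>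

text \<open>The order of the bundles is the assignment: the additive agent, \<open>f\<close>,
  \<open>g\<close>. Comparisons of a bundle with itself are treated separately.\<close>

definition settles :: "('a set \<Rightarrow> real) \<Rightarrow> ('a set \<Rightarrow> real) \<Rightarrow> 'a set \<Rightarrow> 'a set \<Rightarrow> 'a set \<Rightarrow> bool" where
  "settles f g A B D \<longleftrightarrow> partition3 M A B D
     \<and> tolerates (sum w) A B \<and> tolerates (sum w) A D
     \<and> tolerates f B A \<and> tolerates f B D
     \<and> tolerates g D A \<and> tolerates g D B"

lemma settles_if_keeps:
  assumes f: "mono_within M f" and g: "mono_within M g" and "keeps f A B D"
  shows "\<exists>A B D. settles f g A B D"
  using assms(3)
proof (induction "card M - card D" arbitrary: A B D rule: less_induct)
  case less
  have part: "partition3 M A B D" using less.prems by (simp add: keeps_def)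
  then have sub: "A \<subseteq> M" "B \<subseteq> M" "D \<subseteq> M" by (auto simp: partition3_def)
  have perm: "partition3 M B A D" "partition3 M A D B" "partition3 M B D A"
    using part by (auto simp: partition3_def)
  have w: "tolerates (sum w) A B" "tolerates (sum w) A D"
    "tolerates (sum w) B A" "tolerates (sum w) B D"
    using less.prems sub by (auto intro!: tolerates_if_near simp: keeps_def partition3_def)
  have fD: "tolerates f D A" "tolerates f D B"
    using less.prems sub by (auto intro!: tolerates_if_le[OF f] simp: keeps_def)
  have g_le: "tolerates g P Q" if "g P \<le> g Q" "P \<subseteq> M" "Q \<subseteq> M" for P Q
    using tolerates_if_le[OF g] that by blast
  \<comment> \<open>Agent \<open>g\<close> accepts a bundle that is cheapest for it.\<close>
  consider "tolerates g A B \<and> tolerates g A D" | "tolerates g B A \<and> tolerates g B D"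
    | "tolerates g D A \<and> tolerates g D B"
    using g_le sub by (meson le_cases order_trans)
  then show ?case
  proof cases
    case 1
    then have "settles f g B D A" using w fD perm by (auto simp: settles_def)
    then show ?thesis by blast
  next
    case 2
    then have "settles f g A D B" using w fD perm by (auto simp: settles_def)
    then show ?thesis by blast
  next
    case 3
    show ?thesis
    proof (cases "(tolerates f A B \<and> tolerates f A D) \<or> (tolerates f B A \<and> tolerates f B D)")
      case True
      then have "settles f g B A D \<or> settles f g A B D"
        using 3 w part perm by (auto simp: settles_def)
      then show ?thesis by blast
    next
      case False
      then obtain A' B' D' where k: "keeps f A' B' D'" and c: "card D' = Suc (card D)"
        using keeps_advance[OF f less.prems] by blast
      \<comment> \<open>\<open>D\<close> stays inside the finite set \<open>M\<close>, so its growth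
        makes the measure drop.\<close>
      have "card D' \<le> card M"
        using k finite_M by (intro card_mono) (auto simp: keeps_def partition3_def)
      with c have "card M - card D' < card M - card D" by linarith
      with less.hyps k show ?thesis by blast
    qed
  qed
qed

lemma settles_exists:
  assumes "0 \<le> \<mu>" "mono_within M f" "mono_within M g"
  shows "\<exists>A B D. settles f g A B D"
proof -
  obtain A B D where p: "partition3 M A B D"
    and n: "near A B" "near A D" "near B A" "near B D" "near D A" "near D B"
    using balanced_partition_exists[OF assms(1)] by blast
  have perm: "partition3 M A D B" "partition3 M B D A"
    using p by (auto simp: partition3_def)
  consider "f D \<le> f A \<and> f D \<le> f B" | "f B \<le> f A \<and> f B \<le> f D" | "f A \<le> f B \<and> f A \<le> f D"
    by linarith
  then have "keeps f A B D \<or> keeps f A D B \<or> keeps f B D A"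
    using p n perm by cases (auto simp: keeps_def)
  then show ?thesis using settles_if_keeps[OF assms(2,3)] by blast
qed

end

section \<open>Return to cost functions and allocations\<close>

text \<open>The chores of the larger set are added one at a time.\<close>

lemma mono_within_if_monotone_cost:
  assumes "monotone_cost m C"
  shows "mono_within {0..<m} C"
  unfolding mono_within_def
proof (intro allI impI)
  fix A B :: "nat set" assume "A \<subseteq> B" "B \<subseteq> {0..<m}"
  have "C A \<le> C (A \<union> E)" if "finite E" "E \<subseteq> {0..<m}" for E
    using that
  proof (induction E rule: finite_induct)
    case (insert c E)
    have "A \<union> E \<subseteq> {0..<m}" "c \<in> {0..<m}"
      using insert.prems \<open>A \<subseteq> B\<close> \<open>B \<subseteq> {0..<m}\<close> by auto
    then have "C (A \<union> E) \<le> C (A \<union> E \<union> {c})"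
      using assms unfolding monotone_cost_def by blast
    with insert show ?case by simp
  qed simp
  from this[of B] show "C A \<le> C B"
    using \<open>A \<subseteq> B\<close> \<open>B \<subseteq> {0..<m}\<close> finite_subset by (auto simp: Un_absorb1)
qed

text \<open>Needed because \<open>tEFX3\<close> also ranges over \<open>i = j\<close>.\<close>

lemma tolerates_self:
  assumes "mono_within M f" "P \<subseteq> M"
  shows "tolerates f P P"
  using tolerates_if_le[OF assms(1)] assms(2) by blast

lemma tolerates_additive:
  assumes C: "additive_cost m C" and sub: "P \<subseteq> {0..<m}" "Q \<subseteq> {0..<m}"
    and t: "tolerates (sum (\<lambda>c. C {c})) P Q"
  shows "tolerates C P Q"
  unfolding tolerates_def
proof
  fix c assume c: "c \<in> P"
  have "C S = (\<Sum>c\<in>S. C {c})" if "S \<subseteq> {0..<m}" for S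
    using C that by (simp add: additive_cost_def)
  from this[of "P - {c}"] this[of "insert c Q"]
  have "C (P - {c}) = (\<Sum>c\<in>P - {c}. C {c})" "C (insert c Q) = (\<Sum>c\<in>insert c Q. C {c})"
    using sub c by auto
  with t c show "C (P - {c}) \<le> C (insert c Q)" by (simp add: tolerates_def)
qed

theorem theorem3:
  fixes m :: nat and C :: "nat \<Rightarrow> nat set \<Rightarrow> real" and k :: nat
  assumes "k < 3"
    and "additive_cost m (C k)"
    and "two_ratio_bounded m (C k)"
    and "\<forall>i<3. i \<noteq> k \<longrightarrow> monotone_cost m (C i)"
  shows "\<exists>X. full_allocation3 m X \<and> tEFX3 C X"
proof -
  define w where "w c = C k {c}" for c
  have pos: "w c > 0" if "c \<in> {0..<m}" for c
    using assms(3) that by (simp add: two_ratio_bounded_def w_def)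
  have ratio: "w a \<le> 2 * w b" if "a \<in> {0..<m}" "b \<in> {0..<m}" for a b
    using assms(3) that by (simp add: two_ratio_bounded_def w_def)
  obtain \<mu> where \<mu>: "0 \<le> \<mu>" "\<And>c. c \<in> {0..<m} \<Longrightarrow> \<mu> \<le> w c \<and> w c \<le> 2 * \<mu>"
  \<comment> \<open>Without chores there is no minimum, and 0 serves; otherwise the ratio bound at a
    cheapest chore \<open>b\<close> gives the upper bound \<open>2 * \<mu>\<close>.\<close>
  proof (cases "m = 0")
    case True
    then show ?thesis using that[of 0] by simp
  next
    case False
    define \<mu> where "\<mu> = Min (w ` {0..<m})"
    have "\<mu> \<in> w ` {0..<m}" unfolding \<mu>_def using False by (intro Min_in) auto
    then obtain b where b: "b \<in> {0..<m}" "\<mu> = w b" by blast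
    have "\<mu> \<le> w c" if "c \<in> {0..<m}" for c
      unfolding \<mu>_def using that by (intro Min_le) auto
    then show ?thesis using that[of \<mu>] b pos[of b] ratio by force
  qed
  interpret ratio_bounded_weights "{0..<m}" w \<mu>
    using \<mu> by unfold_locales auto
  obtain i j where ij: "i < 3" "j < 3" "i \<noteq> k" "j \<noteq> k" "i \<noteq> j"
  proof -
    have "k = 0 \<or> k = 1 \<or> k = 2" using \<open>k < 3\<close> by auto
    then show ?thesis using that[of 1 2] that[of 0 2] that[of 0 1] by auto
  qed
  have agents: "n = k \<or> n = i \<or> n = j" if "n < 3" for n
    using that ij \<open>k < 3\<close> by arith
  have mono: "mono_within {0..<m} (C i)" "mono_within {0..<m} (C j)"
    using assms(4) ij by (auto intro: mono_within_if_monotone_cost)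
  obtain A B D where s: "settles (C i) (C j) A B D"
    using settles_exists[OF \<mu>(1) mono] by blast
  have part: "partition3 {0..<m} A B D" using s by (simp add: settles_def)
  then have sub: "A \<subseteq> {0..<m}" "B \<subseteq> {0..<m}" "D \<subseteq> {0..<m}" by (auto simp: partition3_def)
  \<comment> \<open>Here \<open>insert c A = A\<close>, so positivity of \<open>w c\<close>
    suffices.\<close>
  have "tolerates (sum w) A A"
    using \<mu> sub by (auto simp: tolerates_def insert_absorb sum_w_remove dest: pos less_imp_le)
  then have tk: "tolerates (C k) A A" "tolerates (C k) A B" "tolerates (C k) A D"
    using s sub unfolding settles_def w_def by (auto intro: tolerates_additive[OF assms(2)])
  have ti: "tolerates (C i) B A" "tolerates (C i) B B" "tolerates (C i) B D"
    using s sub tolerates_self[OF mono(1)] by (auto simp: settles_def)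
  have tj: "tolerates (C j) D A" "tolerates (C j) D B" "tolerates (C j) D D"
    using s sub tolerates_self[OF mono(2)] by (auto simp: settles_def)
  define X where "X n = (if n = k then A else if n = i then B else D)" for n
  have X: "X k = A" "X i = B" "X j = D" using ij by (auto simp: X_def)
  have idx: "{..<3} = {k, i, j}" using agents ij \<open>k < 3\<close> by auto
  have "(\<Union>n<3. X n) = {0..<m}"
    unfolding idx using X part by (auto simp: partition3_def)
  moreover have "X p \<inter> X q = {}" if "p < 3" "q < 3" "p \<noteq> q" for p q
    using agents[OF that(1)] agents[OF that(2)] that(3) X part
    by (auto simp: partition3_def)
  ultimately have "full_allocation3 m X" by (auto simp: full_allocation3_def)
  moreover have "tolerates (C p) (X p) (X q)" if "p < 3" "q < 3" for p q
    using agents[OF that(1)] agents[OF that(2)] X tk ti tj by auto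
  then have "tEFX3 C X" by (auto simp: tEFX3_def tolerates_def)
  ultimately show ?thesis by blast
qed

end
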